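(* In the setting described in the context, for every $\varepsilon$ with $0\le\varepsilon<1-E_{\min}$, $$\frac{\langle\omega_\varepsilon(\mathcal S)\rangle_{\mathcal S}}{\langle\omega(\mathcal S)\rangle_{\mathcal S}}=\frac{\int_{E_{\min}+\varepsilon}^1(1-E)^nD(E)\,dE}{\int_0^1(1-E)^nD(E)\,dE}\le\frac{\Omega_\varepsilon}{\Omega}\cdot\frac{1}{(1-g_{\varepsilon/2})+g_{\varepsilon/2}\,e^{\frac{\varepsilon}{2}n}},$$ and, if $g_{\varepsilon/2}>0$, the right-hand side is moreover bounded by $$\frac{1}{g_{\varepsilon/2}}\,e^{-\frac{\varepsilon}{2}n}.$$
   Context: Setting. $P(x,y)$ is a probability distribution on pairs (input $x$, label $y$). $\mathcal W\subseteq\mathbb R^N$ is a compact set of non-zero Lebesgue measure; each $w\in\mathcal W$ determines a classifier $h_w$ mapping inputs to labels, and $\mathcal H_{\mathcal W}=\{h_w: w\in\mathcal W\}$ has finite VC-dimension. The loss is $L(y,h_w(x))\in\{0,1\}$, equal to $0$ if $h_w(x)=y$ and $1$ otherwise. The map $(w,x,y)\mapsto L(y,h_w(x))$ is jointly measurable. The true error of $w$ is $E(w)=\int L(y,h_w(x))\,dP(x,y)\in[0,1]$; it is integrable on $\mathcal W$, and $E_{\min}=\min_{w\in\mathcal W}E(w)$ (assumed attained). Training sets. $n\ge 1$ is an integer and $\mathcal S=\{(x_1,y_1),\dots,(x_n,y_n)\}$ is drawn i.i.d. from $P(x,y)$, i.e. $\mathcal S\sim P(x,y)^n$. The training error is $E_{\mathcal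 S}(w)=\frac1n\sum_{i=1}^nL(y_i,h_w(x_i))$. $\langle\cdot\rangle_{\mathcal S}$ denotes expectation over $\mathcal S$. Parameter sets and volumes, for $\varepsilon\ge0$: $\mathcal W_\varepsilon=\{w\in\mathcal W:E(w)\ge E_{\min}+\varepsilon\}$; $\mathcal W(\mathcal S)=\{w\in\mathcal W:E_{\mathcal S}(w)=0\}$; $\mathcal W_\varepsilon(\mathcal S)=\{w\in\mathcal W_\varepsilon:E_{\mathcal S}(w)=0\}$. With $|\cdot|$ Lebesgue measure, $\Omega=|\mathcal W|$, $\Omega_\varepsilon=|\mathcal W_\varepsilon|$, $\omega(\mathcal S)=|\mathcal W(\mathcal S)|$, $\omega_\varepsilon(\mathcal S)=|\mathcal W_\varepsilon(\mathcal S)|$. Over-parameterization assumption: $\omega(\mathcal S)>0$ for almost all $\mathcal S$ of size $n$. The fraction of good classifiers is $g_\varepsilon=(\Omega-\Omega_\varepsilon)/\Omega$. Density of classifiers. $D(E)$ is the density on $[0,1]$ (with $D(E)=0$ for $E<E_{\min}$) such that $\Omega_\varepsilon=\int_{E_{\min}+\varepsilon}^1D(E)\,dE$ for each $0\le\varepsilon\le1-E_{\min}$. It is understood in the generalized sense: $D(E)\,dE$ is the image of Lebesgue measure on $\mathcal W$ under $w\mapsto E(w)$, point masses are allowed, and $\int_{E_{\min}+\varepsilon}^1$ and $\int_0^1$ include both endpoints. *)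

theory Defs
  imports "HOL-Probability.Probability" "HOL-Library.Extended_Nat"
begin

definition zero_one_loss :: "'y \<Rightarrow> 'y \<Rightarrow> real" where
  "zero_one_loss y y' = (if y' = y then 0 else 1)"

lemma zero_one_loss_eq_1_iff: "zero_one_loss y y' = 1 \<longleftrightarrow> y' \<noteq> y"
  by (simp add: zero_one_loss_def)

text \<open>
  The VC-dimension is taken for arbitrary label sets: a set \<open>A\<close> of (input, label) pairs is
  shattered if the classifiers of \<open>H\<close> realise every error pattern on \<open>A\<close>. For two labels this
  is the usual VC-dimension of a family of subsets of the input space, see
  \<open>vc_dimension_binary\<close> below.
\<close>

definition shatters :: "('x \<Rightarrow> 'y) set \<Rightarrow> ('x \<times> 'y) set \<Rightarrow> bool" where
  "shatters H A \<longleftrightarrow> (\<forall>B\<subseteq>A. \<exists>h\<in>H. {(x, y) \<in> A. zero_one_loss y (h x) = 1} = B)"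

definition vc_dimension :: "('x \<times> 'y) set \<Rightarrow> ('x \<Rightarrow> 'y) set \<Rightarrow> enat" where
  "vc_dimension Z H = (SUP A\<in>{A. A \<subseteq> Z \<and> finite A \<and> shatters H A}. enat (card A))"

lemma vc_dimension_binary:
  fixes H :: "('x \<Rightarrow> bool) set"
  shows "vc_dimension (X \<times> UNIV) H =
    (SUP A\<in>{A. A \<subseteq> X \<and> finite A \<and> (\<forall>B\<subseteq>A. \<exists>h\<in>H. {x \<in> A. h x} = B)}. enat (card A))"
    (is "_ = ?R")
proof (rule antisym)
  show "vc_dimension (X \<times> UNIV) H \<le> ?R"
    unfolding vc_dimension_def
  proof (rule SUP_mono)
    fix A :: "('x \<times> bool) set"
    assume "A \<in> {A. A \<subseteq> X \<times> UNIV \<and> finite A \<and> shatters H A}"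
    then have A: "A \<subseteq> X \<times> UNIV" "finite A" "shatters H A" by auto
    have sh: "\<exists>h\<in>H. \<forall>x y. (x, y) \<in> A \<longrightarrow> (h x \<noteq> y \<longleftrightarrow> (x, y) \<in> B)" if "B \<subseteq> A" for B
    proof -
      have "\<exists>h\<in>H. {(x, y) \<in> A. zero_one_loss y (h x) = 1} = B"
        using A(3) that unfolding shatters_def by simp
      then obtain h where "h \<in> H" "{(x, y) \<in> A. zero_one_loss y (h x) = 1} = B"
        by (rule bexE)
      then show ?thesis
        by (intro bexI[of _ h]) (auto simp: zero_one_loss_eq_1_iff)
    qed
    have inj: "inj_on fst A"
    proof -
      obtain h where h: "\<And>x y. (x, y) \<in> A \<Longrightarrow> h x = y" using sh[of "{}"] by auto
      show ?thesis
      proof (rule inj_onI)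
        fix p q assume "p \<in> A" "q \<in> A" "fst p = fst q"
        moreover from this have "h (fst p) = snd p" "h (fst q) = snd q"
          by (metis h prod.collapse)+
        ultimately show "p = q" by (simp add: prod_eq_iff)
      qed
    qed
    have "\<exists>h\<in>H. {x \<in> fst ` A. h x} = B" if B: "B \<subseteq> fst ` A" for B
    proof -
      obtain h where "h \<in> H" and
        h: "\<And>x y. (x, y) \<in> A \<Longrightarrow> h x \<noteq> y \<longleftrightarrow> (x, y) \<in> {p \<in> A. fst p \<in> B \<longleftrightarrow> \<not> snd p}"
        using sh[of "{p \<in> A. fst p \<in> B \<longleftrightarrow> \<not> snd p}"] by auto
      have "h x \<longleftrightarrow> x \<in> B" if "x \<in> fst ` A" for x
      proof -
        from that obtain y where y: "(x, y) \<in> A" by auto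
        show ?thesis using h[OF y] y by auto
      qed
      then have "{x \<in> fst ` A. h x} = B" using B by (auto simp only: subset_iff)
      then show ?thesis using \<open>h \<in> H\<close> by (rule bexI)
    qed
    moreover have "card (fst ` A) = card A" using inj by (rule card_image)
    ultimately show "\<exists>C\<in>{A. A \<subseteq> X \<and> finite A \<and> (\<forall>B\<subseteq>A. \<exists>h\<in>H. {x \<in> A. h x} = B)}.
        enat (card A) \<le> enat (card C)"
      using A(1,2) by (intro bexI[of _ "fst ` A"]) auto
  qed
next
  show "?R \<le> vc_dimension (X \<times> UNIV) H"
    unfolding vc_dimension_def
  proof (rule SUP_mono)
    fix A assume "A \<in> {A. A \<subseteq> X \<and> finite A \<and> (\<forall>B\<subseteq>A. \<exists>h\<in>H. {x \<in> A. h x} = B)}"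
    then have A: "A \<subseteq> X" "finite A" "\<And>B. B \<subseteq> A \<Longrightarrow> \<exists>h\<in>H. {x \<in> A. h x} = B" by auto
    have "\<exists>h\<in>H. {(x, y) \<in> A \<times> {False}. zero_one_loss y (h x) = 1} = B"
      if B: "B \<subseteq> A \<times> {False}" for B
    proof -
      have "fst ` B \<subseteq> A" using B by auto
      then obtain h where h: "h \<in> H" "{x \<in> A. h x} = fst ` B"
        using A(3) by blast
      have "{(x, y) \<in> A \<times> {False}. zero_one_loss y (h x) = 1} = {x \<in> A. h x} \<times> {False}"
        by (auto simp: zero_one_loss_eq_1_iff)
      also have "\<dots> = B" unfolding h(2) using B by force
      finally show ?thesis using h(1) by (rule bexI)
    qed
    then have "shatters H (A \<times> {False})" unfolding shatters_def by simp
    then show "\<exists>C\<in>{A. A \<subseteq> X \<times> UNIV \<and> finite A \<and> shatters H A}. enat (card A) \<le> enat (card C)"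
      using A(1,2) by (intro bexI[of _ "A \<times> {False}"]) (auto simp: card_cartesian_product)
  qed
qed

definition true_error :: "('x \<times> 'y) measure \<Rightarrow> ('w \<Rightarrow> 'x \<Rightarrow> 'y) \<Rightarrow> 'w \<Rightarrow> real" where
  "true_error P h w = (\<integral>(x, y). zero_one_loss y (h w x) \<partial>P)"

definition train_error :: "('w \<Rightarrow> 'x \<Rightarrow> 'y) \<Rightarrow> nat \<Rightarrow> (nat \<Rightarrow> 'x \<times> 'y) \<Rightarrow> 'w \<Rightarrow> real" where
  "train_error h n S w = (1 / real n) * (\<Sum>i=1..n. zero_one_loss (snd (S i)) (h w (fst (S i))))"

definition training_sets :: "('x \<times> 'y) measure \<Rightarrow> nat \<Rightarrow> (nat \<Rightarrow> 'x \<times> 'y) measure" where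
  "training_sets P n = Pi\<^sub>M {1..n} (\<lambda>_. P)"

definition min_error :: "'w set \<Rightarrow> ('x \<times> 'y) measure \<Rightarrow> ('w \<Rightarrow> 'x \<Rightarrow> 'y) \<Rightarrow> real" where
  "min_error W P h = (INF w\<in>W. true_error P h w)"

definition bad_params ::
    "'w set \<Rightarrow> ('x \<times> 'y) measure \<Rightarrow> ('w \<Rightarrow> 'x \<Rightarrow> 'y) \<Rightarrow> real \<Rightarrow> 'w set" where
  "bad_params W P h \<epsilon> = {w \<in> W. true_error P h w \<ge> min_error W P h + \<epsilon>}"

definition interpolating :: "'w set \<Rightarrow> ('w \<Rightarrow> 'x \<Rightarrow> 'y) \<Rightarrow> nat \<Rightarrow> (nat \<Rightarrow> 'x \<times> 'y) \<Rightarrow> 'w set" where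
  "interpolating V h n S = {w \<in> V. train_error h n S w = 0}"

abbreviation vol :: "'w::euclidean_space set \<Rightarrow> real" where
  "vol V \<equiv> measure lebesgue V"

definition good_fraction ::
    "'w::euclidean_space set \<Rightarrow> ('x \<times> 'y) measure \<Rightarrow> ('w \<Rightarrow> 'x \<Rightarrow> 'y) \<Rightarrow> real \<Rightarrow> real" where
  "good_fraction W P h \<epsilon> = (vol W - vol (bad_params W P h \<epsilon>)) / vol W"

text \<open>
  The generalised density of classifiers, as the measure \<open>D(E) dE\<close>; integrals against the
  density are integrals with respect to this measure.
\<close>

definition classifier_density ::
    "'w::euclidean_space set \<Rightarrow> ('x \<times> 'y) measure \<Rightarrow> ('w \<Rightarrow> 'x \<Rightarrow> 'y) \<Rightarrow> real measure" where
  "classifier_density W P h = distr (lebesgue_on W) borel (true_error P h)"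

lemma true_error_le_1:
  assumes "prob_space P"
  shows "true_error P h w \<le> 1"
proof -
  interpret prob_space P by fact
  show ?thesis
  proof (cases "integrable P (\<lambda>(x, y). zero_one_loss y (h w x))")
    case True
    then have "true_error P h w \<le> (\<integral>z. 1 \<partial>P)"
      unfolding true_error_def
      by (intro integral_mono) (auto simp: zero_one_loss_def split: prod.splits)
    then show ?thesis by (simp add: prob_space)
  next
    case False
    then show ?thesis unfolding true_error_def by (simp add: not_integrable_integral_eq)
  qed
qed

lemma vol_bad_params_eq_density:
  assumes "prob_space P" and W: "W \<in> sets lebesgue"
    and E: "true_error P h \<in> borel_measurable (lebesgue_on W)"
  shows "vol (bad_params W P h \<epsilon>) = measure (classifier_density W P h) {min_error W P h + \<epsilon>..1}"
proof -
  have *: "true_error P h -` {min_error W P h + \<epsilon>..1} \<inter> W = bad_params W P h \<epsilon>"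
    using true_error_le_1[OF assms(1)] by (auto simp: bad_params_def)
  show ?thesis
    unfolding classifier_density_def
    by (subst measure_distr[OF E])
       (use W * in \<open>auto simp: measure_restrict_space bad_params_def\<close>)
qed

end

theory Submission
  imports Defs
begin

text \<open>
  By Fubini and independence, the mean volume of the interpolating part of \<open>V\<close> is the integral
  of \<open>(1 - E)\<^sup>n\<close> over \<open>V\<close>. Cut the parameter set at the errors \<open>E_min + \<epsilon>/2\<close> and \<open>E_min + \<epsilon>\<close>,
  and let \<open>b = (1 - E_min - \<epsilon>)\<^sup>n\<close>. The integrand is at most \<open>b\<close> on the bad part, at least \<open>b\<close> on
  the middle part, and at least \<open>b exp (n \<epsilon>/2)\<close> on the good part; comparing the three integrals
  gives the bound.
\<close>

text \<open>The case of exponent 1 suffices, as all bases are nonnegative. There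
  \<open>(1 - t) * (1 - (m + t))\<close> exceeds \<open>1 - (m + 2 * t)\<close> by exactly
  \<open>t * (m + t)\<close>, and \<open>1 - t\<close> is at most \<open>exp (- t)\<close>.\<close>

lemma exp_mult_power_le:
  fixes m t :: real
  assumes "0 \<le> m" "0 \<le> t" "m + 2 * t \<le> 1"
  shows "exp (t * real n) * (1 - (m + 2 * t)) ^ n \<le> (1 - (m + t)) ^ n"
proof -
  have "exp t * (1 - (m + 2 * t)) \<le> 1 - (m + t)"
  proof -
    have "1 - (m + 2 * t) \<le> (1 - t) * (1 - (m + t))"
      using assms mult_nonneg_nonneg[of t "m + t"] by (simp add: algebra_simps)
    also have "\<dots> \<le> exp (- t) * (1 - (m + t))"
      using assms exp_ge_add_one_self[of "- t"] by (intro mult_right_mono) auto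
    finally have "exp t * (1 - (m + 2 * t)) \<le> exp t * (exp (- t) * (1 - (m + t)))"
      by (intro mult_left_mono) auto
    then show ?thesis by (simp add: mult.assoc[symmetric] exp_minus_inverse)
  qed
  then have "(exp t * (1 - (m + 2 * t))) ^ n \<le> (1 - (m + t)) ^ n"
    using assms by (intro power_mono) auto
  then show ?thesis
    by (simp add: power_mult_distrib exp_of_nat_mult[symmetric] mult.commute)
qed

text \<open>This is the ratio bound with denominators cleared, so that it also covers a vanishing
  total integral. It is meant for \<open>m\<close> the minimal error and \<open>t\<close> half of
  \<epsilon>. The integral over the tail times the measure of the tail occurs on both sides, so only
  the two other parts have to be compared.\<close>

lemma (in finite_measure) set_integral_power_tail_le:
  fixes e :: "'a \<Rightarrow> real"
  defines "B \<equiv> \<lambda>s. {x \<in> space M. s \<le> e x}"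
  assumes e [measurable]: "e \<in> borel_measurable M"
    and range: "\<And>x. x \<in> space M \<Longrightarrow> 0 \<le> e x \<and> e x \<le> 1"
    and m: "0 \<le> m" and t: "0 \<le> t" and le_1: "m + 2 * t \<le> 1"
  shows "(LINT x:B (m + 2 * t)|M. (1 - e x) ^ n)
      * (measure M (B (m + t)) + (measure M (space M) - measure M (B (m + t))) * exp (t * real n))
    \<le> measure M (B (m + 2 * t)) * (LINT x|M. (1 - e x) ^ n)"
proof -
  define f where "f = (\<lambda>x. (1 - e x) ^ n)"
  \<comment> \<open>\<open>A\<close> is the bad part, \<open>C\<close> the middle and
    \<open>G\<close> the good part; \<open>b\<close> is the value of the integrand at the cut
    between \<open>A\<close> and \<open>C\<close>, against which all three are measured.\<close>
  define A where "A = B (m + 2 * t)"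
  define C where "C = B (m + t) - A"
  define G where "G = space M - B (m + t)"
  define b where "b = (1 - (m + 2 * t)) ^ n"
  have meas [measurable]: "A \<in> sets M" "B (m + t) \<in> sets M" "C \<in> sets M" "G \<in> sets M"
    unfolding A_def B_def C_def G_def by measurable
  have f_meas [measurable]: "f \<in> borel_measurable M"
    unfolding f_def by measurable
  have f_int: "integrable M f"
    by (rule integrable_const_bound[where B = 1])
       (use range in \<open>auto simp: f_def power_le_one\<close>)
  have f_int_on: "set_integrable M X f" if "X \<in> sets M" for X
    using integrable_mult_indicator[OF that f_int] by (simp add: set_integrable_def)
  have const_int_on: "set_integrable M X (\<lambda>_. c)" if "X \<in> sets M" for X and c :: real
    using that by (auto simp: set_integrable_def less_top[symmetric])
  have const: "(LINT x:X|M. c) = c * measure M X" if "X \<in> sets M" for X and c :: real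
    using that sets.sets_into_space[OF that]
    by (simp add: set_lebesgue_integral_def Int_absorb2)
  have "A \<subseteq> B (m + t)" using t unfolding A_def B_def by auto
  then have B_eq: "B (m + t) = C \<union> A" unfolding C_def by auto
  then have M_eq: "space M = G \<union> (C \<union> A)"
    using sets.sets_into_space[OF meas(2)] unfolding G_def by auto
  have disj: "C \<inter> A = {}" "G \<inter> (C \<union> A) = {}"
    unfolding B_eq[symmetric] unfolding C_def G_def by auto
  have mB: "measure M (B (m + t)) = measure M C + measure M A"
    unfolding B_eq using disj by (intro finite_measure_Union) auto
  have mG: "measure M (space M) - measure M (B (m + t)) = measure M G"
    unfolding G_def by (simp add: finite_measure_compl)
  have split: "(LINT x|M. f x) = (LINT x:G|M. f x) + ((LINT x:C|M. f x) + (LINT x:A|M. f x))"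
  proof -
    have "(LINT x|M. f x) = (LINT x:G \<union> (C \<union> A)|M. f x)"
      using M_eq set_integral_space[OF f_int] by simp
    also have "\<dots> = (LINT x:G|M. f x) + (LINT x:C \<union> A|M. f x)"
      using disj by (intro set_integral_Un f_int_on) auto
    also have "(LINT x:C \<union> A|M. f x) = (LINT x:C|M. f x) + (LINT x:A|M. f x)"
      using disj by (intro set_integral_Un f_int_on) auto
    finally show ?thesis .
  qed
  have b_nonneg: "0 \<le> b" using le_1 by (simp add: b_def)
  have A_le: "(LINT x:A|M. f x) \<le> b * measure M A"
    unfolding const[OF meas(1), symmetric] using range
    by (intro set_integral_mono f_int_on const_int_on)
       (auto simp: A_def B_def f_def b_def intro!: power_mono)
  have C_ge: "b * measure M C \<le> (LINT x:C|M. f x)"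
    unfolding const[OF meas(3), symmetric] using range le_1
    by (intro set_integral_mono f_int_on const_int_on)
       (auto simp: A_def B_def C_def f_def b_def intro!: power_mono)
  \<comment> \<open>On \<open>G\<close> the error stays below \<open>m + t\<close>, a gap of
    \<open>t\<close> from the cut defining \<open>b\<close>; this gap produces the exponential
    factor.\<close>
  have "exp (t * real n) * b \<le> f x" if "x \<in> G" for x
  proof -
    have "exp (t * real n) * b \<le> (1 - (m + t)) ^ n"
      unfolding b_def by (rule exp_mult_power_le[OF m t le_1])
    also have "\<dots> \<le> f x"
      using that le_1 t unfolding f_def by (intro power_mono) (auto simp: G_def B_def)
    finally show ?thesis .
  qed
  then have G_ge: "(exp (t * real n) * b) * measure M G \<le> (LINT x:G|M. f x)"
    unfolding const[OF meas(4), symmetric]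
    by (intro set_integral_mono f_int_on const_int_on) auto
  \<comment> \<open>The factor \<open>b\<close> passes from the upper bound on \<open>A\<close> to
    the lower bounds on \<open>G\<close> and \<open>C\<close>. The summand common to both sides of
    the claim is added back at the end.\<close>
  have "(LINT x:A|M. f x) * (measure M G * exp (t * real n) + measure M C)
      \<le> (b * measure M A) * (measure M G * exp (t * real n) + measure M C)"
    by (intro mult_right_mono A_le) simp
  also have "\<dots> = measure M A * ((exp (t * real n) * b) * measure M G + b * measure M C)"
    by (simp add: algebra_simps)
  also have "\<dots> \<le> measure M A * ((LINT x:G|M. f x) + (LINT x:C|M. f x))"
    by (intro mult_left_mono add_mono G_ge C_ge) simp
  finally show ?thesis
    unfolding mG unfolding mB A_def[symmetric] split[unfolded f_def] by (simp add: algebra_simps f_def)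
qed

lemma zero_one_loss_cases: "zero_one_loss y y' = 0 \<or> zero_one_loss y y' = 1"
  by (simp add: zero_one_loss_def)

lemma true_error_nonneg: "0 \<le> true_error P h w"
  unfolding true_error_def
  by (rule integral_nonneg_AE) (auto simp: zero_one_loss_def)

lemma train_error_eq_0_iff:
  assumes "n \<ge> 1"
  shows "train_error h n S w = 0 \<longleftrightarrow> (\<forall>i\<in>{1..n}. zero_one_loss (snd (S i)) (h w (fst (S i))) = 0)"
proof -
  have "train_error h n S w = 0 \<longleftrightarrow> (\<Sum>i=1..n. zero_one_loss (snd (S i)) (h w (fst (S i)))) = 0"
    using assms by (simp add: train_error_def)
  also have "\<dots> \<longleftrightarrow> (\<forall>i\<in>{1..n}. zero_one_loss (snd (S i)) (h w (fst (S i))) = 0)"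
    by (rule sum_nonneg_eq_0_iff) (auto simp: zero_one_loss_def)
  finally show ?thesis .
qed

text \<open>Each factor is 0 or 1, so a single error on the sample kills the product. The product
  form is what lets independence factor the expectation over training sets.\<close>

lemma indicator_interpolating:
  assumes "n \<ge> 1"
  shows "indicator (interpolating V h n S) w
    = indicator V w * (\<Prod>i=1..n. 1 - zero_one_loss (snd (S i)) (h w (fst (S i))))"
proof (cases "\<forall>i\<in>{1..n}. zero_one_loss (snd (S i)) (h w (fst (S i))) = 0")
  case True
  then show ?thesis
    by (simp add: interpolating_def train_error_eq_0_iff[OF assms] indicator_def)
next
  case False
  then obtain i where "i \<in> {1..n}" "1 - zero_one_loss (snd (S i)) (h w (fst (S i))) = 0"
    using zero_one_loss_cases by fastforce
  then have "(\<Prod>i=1..n. 1 - zero_one_loss (snd (S i)) (h w (fst (S i)))) = 0"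
    by (intro prod_zero) auto
  then show ?thesis
    using False by (simp add: interpolating_def train_error_eq_0_iff[OF assms])
qed

text \<open>Fubini swaps the mean over samples with the integral over parameters. For fixed
  \<open>w\<close> the sample points are independent and each is classified correctly with
  probability \<open>1 - true_error P h w\<close>. A general \<open>V\<close> serves both the
  numerator and the denominator of the ratio.\<close>

lemma expectation_vol_interpolating:
  fixes W :: "'w::euclidean_space set"
  assumes P: "prob_space P" and W: "W \<in> lmeasurable" and n: "n \<ge> 1"
    and loss: "(\<lambda>(w, x, y). zero_one_loss y (h w x)) \<in> borel_measurable (lebesgue_on W \<Otimes>\<^sub>M P)"
    and V: "V \<in> sets (lebesgue_on W)"
  shows "(\<integral>S. vol (interpolating V h n S) \<partial>training_sets P n)
    = (LINT w:V|lebesgue_on W. (1 - true_error P h w) ^ n)"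
proof -
  interpret P: prob_space P by (rule P)
  interpret T: product_prob_space "\<lambda>_. P" "{1..n}" ..
  interpret L: finite_measure "lebesgue_on W"
    using W by (rule finite_measure_lebesgue_on)
  interpret prod: prob_space "Pi\<^sub>M {1..n} (\<lambda>_. P)"
    by (intro prob_space_PiM P)
  interpret LT: pair_sigma_finite "lebesgue_on W" "Pi\<^sub>M {1..n} (\<lambda>_. P)" ..
  define l where "l w z = 1 - zero_one_loss (snd z) (h w (fst z))" for w z
  have l_meas: "(\<lambda>(w, z). l w z) \<in> borel_measurable (lebesgue_on W \<Otimes>\<^sub>M P)"
  proof -
    have "(\<lambda>(w, z). l w z) = (\<lambda>p. 1 - (case p of (w, x, y) \<Rightarrow> zero_one_loss y (h w x)))"
      by (auto simp: l_def)
    then show ?thesis using loss by simp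
  qed
  have VW: "V \<subseteq> W" using sets.sets_into_space[OF V] by simp
  have l_bounds: "0 \<le> l w z" "l w z \<le> 1" for w z
    by (auto simp: l_def zero_one_loss_def)
  let ?F = "\<lambda>w S. indicator V w * (\<Prod>i=1..n. l w (S i))"
  have comp: "(\<lambda>p. l (fst p) (snd p i))
      \<in> borel_measurable (lebesgue_on W \<Otimes>\<^sub>M Pi\<^sub>M {1..n} (\<lambda>_. P))" if "i \<in> {1..n}" for i
  proof -
    have "(\<lambda>p. (fst p, snd p i))
        \<in> (lebesgue_on W \<Otimes>\<^sub>M Pi\<^sub>M {1..n} (\<lambda>_. P)) \<rightarrow>\<^sub>M (lebesgue_on W \<Otimes>\<^sub>M P)"
      using that by (intro measurable_Pair measurable_fst
          measurable_compose[OF measurable_snd measurable_component_singleton])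
    from measurable_compose[OF this l_meas] show ?thesis by simp
  qed
  have "(\<lambda>p. indicator V (fst p) * (\<Prod>i=1..n. l (fst p) (snd p i)) :: real)
      \<in> borel_measurable (lebesgue_on W \<Otimes>\<^sub>M Pi\<^sub>M {1..n} (\<lambda>_. P))"
    by (intro borel_measurable_times borel_measurable_prod comp
        measurable_compose[OF measurable_fst borel_measurable_indicator[OF V]])
  then have F_meas: "(\<lambda>(w, S). ?F w S)
      \<in> borel_measurable (lebesgue_on W \<Otimes>\<^sub>M Pi\<^sub>M {1..n} (\<lambda>_. P))"
    by (simp add: case_prod_unfold)
  interpret prodm: finite_measure "lebesgue_on W \<Otimes>\<^sub>M Pi\<^sub>M {1..n} (\<lambda>_. P)"
    by (rule finite_measure_pair_measure) unfold_locales
  \<comment> \<open>The integrand lies between 0 and 1 and the product measure is finite.\<close>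
  have "integrable (lebesgue_on W \<Otimes>\<^sub>M Pi\<^sub>M {1..n} (\<lambda>_. P)) (\<lambda>(w, S). ?F w S)"
    by (rule prodm.integrable_const_bound[where B = 1, OF _ F_meas])
       (auto simp: indicator_def l_bounds prod_le_1 prod_nonneg abs_of_nonneg)
  note Fubini = LT.Fubini_integral[OF this]
  \<comment> \<open>This holds for every \<open>S\<close>: should the set fail to be measurable, the
    integral of its indicator and its measure both default to 0.\<close>
  have slice: "(\<integral>w. ?F w S \<partial>lebesgue_on W) = vol (interpolating V h n S)" for S
  proof -
    have "(\<integral>w. ?F w S \<partial>lebesgue_on W)
        = (\<integral>w. indicator (interpolating V h n S) w \<partial>lebesgue_on W)"
      by (simp add: indicator_interpolating[OF n] l_def)
    also have "\<dots> = measure (lebesgue_on W) (interpolating V h n S \<inter> W)"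
      by simp
    also have "\<dots> = vol (interpolating V h n S)"
      using VW W by (subst measure_restrict_space)
        (auto simp: interpolating_def fmeasurable_def Int_absorb2 subset_iff intro!: arg_cong[where f = vol])
    finally show ?thesis .
  qed
  have sample: "(\<integral>S. (\<Prod>i=1..n. l w (S i)) \<partial>Pi\<^sub>M {1..n} (\<lambda>_. P)) = (1 - true_error P h w) ^ n"
    if w: "w \<in> W" for w
  proof -
    have "l w \<in> borel_measurable P"
      using measurable_compose[OF measurable_Pair1'[of w] l_meas] w by simp
    then have int: "integrable P (l w)"
      by (intro P.integrable_const_bound[where B = 1]) (auto simp: l_bounds)
    \<comment> \<open>Independence of the sample points enters here.\<close>
    have "(\<integral>S. (\<Prod>i=1..n. l w (S i)) \<partial>Pi\<^sub>M {1..n} (\<lambda>_. P)) = (\<Prod>i=1..n. (\<integral>z. l w z \<partial>P))"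
      using int by (intro T.product_integral_prod) auto
    also have "(\<integral>z. l w z \<partial>P) = 1 - true_error P h w"
    proof -
      have "true_error P h w = (\<integral>z. 1 - l w z \<partial>P)"
        by (simp add: true_error_def l_def case_prod_unfold)
      also have "\<dots> = 1 - (\<integral>z. l w z \<partial>P)"
        using int by (simp add: P.prob_space)
      finally show ?thesis by simp
    qed
    finally show ?thesis by simp
  qed
  have "(\<integral>S. vol (interpolating V h n S) \<partial>training_sets P n)
      = (\<integral>S. (\<integral>w. ?F w S \<partial>lebesgue_on W) \<partial>Pi\<^sub>M {1..n} (\<lambda>_. P))"
    by (simp only: slice training_sets_def)
  also have "\<dots> = (\<integral>w. (\<integral>S. ?F w S \<partial>Pi\<^sub>M {1..n} (\<lambda>_. P)) \<partial>lebesgue_on W)"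
    by (rule Fubini)
  also have "\<dots> = (LINT w:V|lebesgue_on W. (1 - true_error P h w) ^ n)"
    unfolding set_lebesgue_integral_def
    by (rule Bochner_Integration.integral_cong) (use sample in auto)
  finally show ?thesis .
qed

text \<open>Change of variables: the density is an image measure, so integrals over error levels
  pull back to integrals over parameters.\<close>

lemma set_integral_classifier_density:
  fixes f :: "real \<Rightarrow> real"
  assumes "true_error P h \<in> borel_measurable (lebesgue_on W)"
    and "A \<in> sets borel" and "f \<in> borel_measurable borel"
  shows "(LINT E:A|classifier_density W P h. f E)
    = (LINT w:{w \<in> W. true_error P h w \<in> A}|lebesgue_on W. f (true_error P h w))"
proof -
  have "(LINT E:A|classifier_density W P h. f E)
      = (\<integral>w. indicator A (true_error P h w) *\<^sub>R f (true_error P h w) \<partial>lebesgue_on W)"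
    unfolding set_lebesgue_integral_def classifier_density_def
    using assms by (intro integral_distr) auto
  also have "\<dots> = (LINT w:{w \<in> W. true_error P h w \<in> A}|lebesgue_on W. f (true_error P h w))"
    unfolding set_lebesgue_integral_def
    by (rule Bochner_Integration.integral_cong) (auto simp: indicator_def)
  finally show ?thesis .
qed

theorem corollary1:
  fixes W :: "(real ^ 'N) set"
    and h :: "real ^ 'N \<Rightarrow> 'x \<Rightarrow> 'y"
    and P :: "('x \<times> 'y) measure"
    and n :: nat
    and \<epsilon> :: real
  assumes "prob_space P"
    and "compact W"
    and "vol W \<noteq> 0"
    and "vc_dimension (space P) (h ` W) < \<infinity>"
    and "(\<lambda>(w, x, y). zero_one_loss y (h w x)) \<in> borel_measurable (lebesgue_on W \<Otimes>\<^sub>M P)"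
    and "integrable (lebesgue_on W) (true_error P h)"
    and "\<exists>w\<in>W. true_error P h w = min_error W P h"
    and "n \<ge> 1"
    and "AE S in training_sets P n. vol (interpolating W h n S) > 0"
    and "0 \<le> \<epsilon>"
    and "\<epsilon> < 1 - min_error W P h"
  shows
    "(\<integral>S. vol (interpolating (bad_params W P h \<epsilon>) h n S) \<partial>training_sets P n)
        / (\<integral>S. vol (interpolating W h n S) \<partial>training_sets P n)
      = (LINT E:{min_error W P h + \<epsilon>..1}|classifier_density W P h. (1 - E) ^ n)
        / (LINT E:{0..1}|classifier_density W P h. (1 - E) ^ n)
    \<and> (LINT E:{min_error W P h + \<epsilon>..1}|classifier_density W P h. (1 - E) ^ n)
        / (LINT E:{0..1}|classifier_density W P h. (1 - E) ^ n)
      \<le> vol (bad_params W P h \<epsilon>) / vol W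
        * (1 / ((1 - good_fraction W P h (\<epsilon> / 2))
              + good_fraction W P h (\<epsilon> / 2) * exp (\<epsilon> / 2 * real n)))
    \<and> (good_fraction W P h (\<epsilon> / 2) > 0 \<longrightarrow>
        vol (bad_params W P h \<epsilon>) / vol W
          * (1 / ((1 - good_fraction W P h (\<epsilon> / 2))
                + good_fraction W P h (\<epsilon> / 2) * exp (\<epsilon> / 2 * real n)))
        \<le> 1 / good_fraction W P h (\<epsilon> / 2) * exp (- (\<epsilon> / 2) * real n))"
proof -
  note P = assms(1) and loss = assms(5) and n = assms(8)
  have W: "W \<in> lmeasurable" using assms(2) by (rule lmeasurable_compact)
  have E: "true_error P h \<in> borel_measurable (lebesgue_on W)"
    using assms(6) by (rule borel_measurable_integrable)
  interpret L: finite_measure "lebesgue_on W"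
    using W by (rule finite_measure_lebesgue_on)
  define m where "m = min_error W P h"
  define g where "g = good_fraction W P h (\<epsilon> / 2)"
  define x where "x = exp (\<epsilon> / 2 * real n)"
  define I where "I = (LINT w:bad_params W P h \<epsilon>|lebesgue_on W. (1 - true_error P h w) ^ n)"
  define Z where "Z = (LINT w:W|lebesgue_on W. (1 - true_error P h w) ^ n)"
  \<comment> \<open>\<open>min_error\<close> is defined as an infimum; being attained, it is itself
    a true error.\<close>
  have m: "0 \<le> m" using assms(7) true_error_nonneg m_def by metis
  have bad_eq: "bad_params W P h t = {w \<in> W. m + t \<le> true_error P h w}" for t
    by (auto simp: bad_params_def m_def)
  have bad_sets: "bad_params W P h t \<in> sets (lebesgue_on W)" for t
  proof -
    have "{w \<in> space (lebesgue_on W). m + t \<le> true_error P h w} \<in> sets (lebesgue_on W)"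
      using E by measurable
    then show ?thesis by (simp add: bad_eq)
  qed
  have W_sets: "W \<in> sets (lebesgue_on W)"
    using sets.top[of "lebesgue_on W"] by simp
  have vol_eq: "measure (lebesgue_on W) V = vol V" if "V \<subseteq> W" for V
    using that W by (intro measure_restrict_space) (auto simp: fmeasurable_def)
  have vol_bad: "measure (lebesgue_on W) (bad_params W P h t) = vol (bad_params W P h t)" for t
    by (rule vol_eq) (auto simp: bad_params_def)
  have vol_bad_le: "vol (bad_params W P h t) \<le> vol W" for t
    unfolding vol_bad[symmetric] vol_eq[OF subset_refl, symmetric]
    using W_sets by (intro L.finite_measure_mono) (auto simp: bad_params_def)
  have vol_W: "0 < vol W" using assms(3) measure_nonneg[of lebesgue W] by linarith
  \<comment> \<open>These two identities turn the volumes in the tail estimate into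
    \<open>vol W\<close> times \<open>1 - g\<close> and \<open>g\<close>.\<close>
  have g1: "vol W * (1 - g) = vol (bad_params W P h (\<epsilon> / 2))"
    and g2: "vol W * g = vol W - vol (bad_params W P h (\<epsilon> / 2))"
    using vol_W by (auto simp: g_def good_fraction_def field_simps)
  have g: "0 \<le> g" "g \<le> 1"
    using vol_W vol_bad_le[of "\<epsilon> / 2"] by (auto simp: g_def good_fraction_def)
  have x: "0 < x" by (simp add: x_def)
  \<comment> \<open>For \<open>g = 0\<close> the sum is 1; otherwise \<open>g * x\<close> is already
    positive.\<close>
  have D: "0 < (1 - g) + g * x"
    using g x by (cases "g = 0") (auto intro: add_nonneg_pos)
  have numer: "(LINT E:{min_error W P h + \<epsilon>..1}|classifier_density W P h. (1 - E) ^ n) = I"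
  proof -
    \<comment> \<open>Errors never exceed 1, so the closed upper end of the interval cuts nothing
      off.\<close>
    have "{w \<in> W. true_error P h w \<in> {min_error W P h + \<epsilon>..1}} = bad_params W P h \<epsilon>"
      using true_error_le_1[OF P] by (auto simp: bad_params_def)
    then show ?thesis
      by (subst set_integral_classifier_density[OF E]) (auto simp: I_def)
  qed
  have denom: "(LINT E:{0..1}|classifier_density W P h. (1 - E) ^ n) = Z"
  proof -
    have "{w \<in> W. true_error P h w \<in> {0..1}} = W"
      using true_error_le_1[OF P] true_error_nonneg by auto
    then show ?thesis
      by (subst set_integral_classifier_density[OF E]) (auto simp: Z_def)
  qed
  have Z_eq: "Z = (LINT w|lebesgue_on W. (1 - true_error P h w) ^ n)"
    unfolding Z_def set_lebesgue_integral_def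
    by (rule Bochner_Integration.integral_cong) auto
  have Z_nonneg: "0 \<le> Z"
    unfolding Z_eq using true_error_le_1[OF P] by (intro Bochner_Integration.integral_nonneg zero_le_power) simp
  have "I * (vol (bad_params W P h (\<epsilon> / 2)) + (vol W - vol (bad_params W P h (\<epsilon> / 2))) * x)
      \<le> vol (bad_params W P h \<epsilon>) * Z"
    using L.set_integral_power_tail_le[OF E _ m, where t = "\<epsilon> / 2" and n = n]
      true_error_nonneg[of P h] true_error_le_1[OF P, of h] assms(10,11)
    by (simp add: bad_eq[symmetric] vol_bad vol_eq I_def Z_eq x_def m_def[symmetric])
  then have *: "I * (vol W * ((1 - g) + g * x)) \<le> vol (bad_params W P h \<epsilon>) * Z"
    unfolding g1[symmetric] g2[symmetric] by (simp add: algebra_simps)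
  then have ratio: "I / Z \<le> vol (bad_params W P h \<epsilon>) / vol W * (1 / ((1 - g) + g * x))"
  proof (cases "Z = 0")
    \<comment> \<open>With \<open>Z = 0\<close> the quotient \<open>I / Z\<close> is 0 by
      convention, and the right-hand side is nonnegative.\<close>
    case True
    then show ?thesis using vol_W D by simp
  next
    case False
    have "0 < vol W * ((1 - g) + g * x)" using vol_W D by (rule mult_pos_pos)
    moreover have "0 < Z" using False Z_nonneg by simp
    ultimately have "I / Z \<le> vol (bad_params W P h \<epsilon>) / (vol W * ((1 - g) + g * x))"
      using * by (simp only: pos_divide_le_eq pos_le_divide_eq times_divide_eq_left
          times_divide_eq_right mult.commute)
    then show ?thesis by simp
  qed
  have bound: "vol (bad_params W P h \<epsilon>) / vol W * (1 / ((1 - g) + g * x))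
      \<le> 1 / g * exp (- (\<epsilon> / 2) * real n)" if "0 < g"
  proof -
    \<comment> \<open>The bad part has at most the full volume, and dropping
      \<open>1 - g \<ge> 0\<close> shrinks the denominator.\<close>
    have "vol (bad_params W P h \<epsilon>) / vol W * (1 / ((1 - g) + g * x)) \<le> 1 * (1 / (g * x))"
      using vol_bad_le[of \<epsilon>] vol_W g x that
      by (intro mult_mono frac_le) auto
    also have "\<dots> = 1 / g * exp (- (\<epsilon> / 2) * real n)"
      by (simp add: x_def exp_minus field_simps)
    finally show ?thesis .
  qed
  show ?thesis
    \<comment> \<open>Both fractions become literally \<open>I / Z\<close>, which settles the
      equality.\<close>
    unfolding numer denom g_def[symmetric] x_def[symmetric]
      expectation_vol_interpolating[OF P W n loss bad_sets]
      expectation_vol_interpolating[OF P W n loss W_sets]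
      I_def[symmetric] Z_def[symmetric]
    using ratio bound by simp
qed

end
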